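(* Let $n\ge 2$, let $K=\mathbb{Z}[t_1^{\pm1},\dots,t_n^{\pm1},q_1^{\pm1},\dots,q_n^{\pm1}]$, let $M$ be the free left $K$-module with basis $e_1,\dots,e_n$, and let $X$ be the additive group of $M$. For $j=1,\dots,n-1$ let $R_j,G_j\in\mathrm{Aut}(X)$ be the automorphisms of the abelian group $X$ defined by $$R_j\Big(\sum_{k=1}^n\alpha_ke_k\Big)=\sum_{k=1}^n\alpha_k^{(j)}R_j(e_k),\qquad G_j\Big(\sum_{k=1}^n\alpha_ke_k\Big)=\sum_{k=1}^n\alpha_k^{(j)}G_j(e_k),\qquad \alpha_k\in K,$$ where $\alpha^{(j)}$ is the image of $\alpha\in K$ under the ring automorphism of $K$ that swaps $t_j$ with $t_{j+1}$ and $q_j$ with $q_{j+1}$ and fixes all other $t_k,q_k$, and $$R_j(e_j)=(1-t_{j+1})e_j+t_je_{j+1},\quad R_j(e_{j+1})=e_j,\qquad G_j(e_j)=q_je_{j+1},\quad G_j(e_{j+1})=q_{j+1}^{-1}e_j,$$ and $R_j(e_k)=G_j(e_k)=e_k$ for $k\ne j,j+1$. Then the map $\varphi_{3B}:\{\sigma_1,\dots,\sigma_{n-1},\rho_1,\dots,\rho_{n-1}\}\to\mathrm{Aut}(X)$, $\sigma_j\mapsto R_j$, $\rho_j\mapsto G_j$, induces a representation of the virtual braid group $VB_n$. The restriction of $\varphi_{3B}$ to the virtual pure braid group $VP_n$ is a linear representation $\varphi_{3B}:VP_n\to\mathrm{GL}_n(K)$ (i.e. its values are $K$-linear automorphisms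 of $M$).
   Context: Composition: maps act on the right, $fg(x)=g(f(x))$; this is also the product in automorphism groups. The virtual braid group $VB_n$ has generators $\sigma_1,\dots,\sigma_{n-1},\rho_1,\dots,\rho_{n-1}$ and relations $\sigma_i\sigma_{i+1}\sigma_i=\sigma_{i+1}\sigma_i\sigma_{i+1}$, $\rho_i\rho_{i+1}\rho_i=\rho_{i+1}\rho_i\rho_{i+1}$, $\rho_{i+1}\sigma_i\rho_{i+1}=\rho_i\sigma_{i+1}\rho_i$ ($1\le i\le n-2$); $\sigma_i\sigma_j=\sigma_j\sigma_i$, $\rho_i\rho_j=\rho_j\rho_i$, $\sigma_i\rho_j=\rho_j\sigma_i$ ($|i-j|\ge 2$); $\rho_i^2=1$ ($1\le i\le n-1$). The virtual pure braid group $VP_n$ is the kernel of the homomorphism $VB_n\to\Sigma_n$, $\sigma_i,\rho_i\mapsto(i,\,i+1)$. *)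

theory Defs
  imports "HOL-Library.Poly_Mapping" "HOL-Algebra.Algebra"
begin

section \<open>Groups acting on the right\<close>

text \<open>The library composes permutations (\<open>sym_group\<close>) and automorphisms (\<open>AutoGroup\<close>) from right
  to left. Here maps act on the right, so that \<open>fg(x) = g(f(x))\<close>.\<close>

definition opposite :: "('a, 'b) monoid_scheme \<Rightarrow> ('a, 'b) monoid_scheme"
  where "opposite G = G\<lparr>monoid.mult := \<lambda>x y. y \<otimes>\<^bsub>G\<^esub> x\<rparr>"

lemma opposite_simps [simp]:
  "carrier (opposite G) = carrier G"
  "x \<otimes>\<^bsub>opposite G\<^esub> y = y \<otimes>\<^bsub>G\<^esub> x"
  "\<one>\<^bsub>opposite G\<^esub> = \<one>\<^bsub>G\<^esub>"
  by (simp_all add: opposite_def)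

lemma group_opposite:
  assumes "group G" shows "group (opposite G)"
proof -
  interpret group G by fact
  show ?thesis
    by (rule groupI) (auto simp: m_assoc intro: r_inv)
qed


section \<open>Groups given by generators and relations\<close>

text \<open>A letter \<open>(s, True)\<close> stands for the generator \<open>s\<close>, and \<open>(s, False)\<close> for its inverse.
  A relation is a pair of words.\<close>

type_synonym 'a gword = "('a \<times> bool) list"

definition gwords :: "'a set \<Rightarrow> 'a gword set"
  where "gwords S = lists (S \<times> UNIV)"

inductive_set word_cong :: "'a set \<Rightarrow> ('a gword \<times> 'a gword) set \<Rightarrow> ('a gword \<times> 'a gword) set"
  for S R where
  refl: "w \<in> gwords S \<Longrightarrow> (w, w) \<in> word_cong S R"
| sym: "(v, w) \<in> word_cong S R \<Longrightarrow> (w, v) \<in> word_cong S R"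
| trans: "(u, v) \<in> word_cong S R \<Longrightarrow> (v, w) \<in> word_cong S R \<Longrightarrow> (u, w) \<in> word_cong S R"
| cancel: "u \<in> gwords S \<Longrightarrow> v \<in> gwords S \<Longrightarrow> s \<in> S \<Longrightarrow>
    (u @ [(s, b), (s, \<not> b)] @ v, u @ v) \<in> word_cong S R"
| rel: "u \<in> gwords S \<Longrightarrow> v \<in> gwords S \<Longrightarrow> l \<in> gwords S \<Longrightarrow> r \<in> gwords S \<Longrightarrow> (l, r) \<in> R \<Longrightarrow>
    (u @ l @ v, u @ r @ v) \<in> word_cong S R"

definition presented_group :: "'a set \<Rightarrow> ('a gword \<times> 'a gword) set \<Rightarrow> 'a gword set monoid"
  where "presented_group S R =
    \<lparr>carrier = gwords S // word_cong S R,
     monoid.mult = (\<lambda>A B. \<Union>v\<in>A. \<Union>w\<in>B. word_cong S R `` {v @ w}),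
     one = word_cong S R `` {[]}\<rparr>"

definition pgen :: "'a set \<Rightarrow> ('a gword \<times> 'a gword) set \<Rightarrow> 'a \<Rightarrow> 'a gword set"
  where "pgen S R s = word_cong S R `` {[(s, True)]}"

primrec word_eval :: "('b, 'c) monoid_scheme \<Rightarrow> ('a \<Rightarrow> 'b) \<Rightarrow> 'a gword \<Rightarrow> 'b"
  where
    "word_eval G f [] = \<one>\<^bsub>G\<^esub>"
  | "word_eval G f (x # w) = (if snd x then f (fst x) else inv\<^bsub>G\<^esub> f (fst x)) \<otimes>\<^bsub>G\<^esub> word_eval G f w"

text \<open>The map out of the presented group induced by a map on the generators. It is meaningful when
  the images of the generators satisfy the relations, see \<open>presented_lift_hom\<close>.\<close>

definition presented_lift ::
    "'a set \<Rightarrow> ('a gword \<times> 'a gword) set \<Rightarrow> ('b, 'c) monoid_scheme \<Rightarrow> ('a \<Rightarrow> 'b) \<Rightarrow> 'a gword set \<Rightarrow> 'b"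
  where "presented_lift S R G f A = word_eval G f (SOME w. w \<in> A)"

lemma gwords_simps [simp]:
  "[] \<in> gwords S"
  "x # w \<in> gwords S \<longleftrightarrow> fst x \<in> S \<and> w \<in> gwords S"
  "v @ w \<in> gwords S \<longleftrightarrow> v \<in> gwords S \<and> w \<in> gwords S"
  by (cases x; auto simp: gwords_def)+

lemma word_cong_gwords: "(v, w) \<in> word_cong S R \<Longrightarrow> v \<in> gwords S \<and> w \<in> gwords S"
  by (induction rule: word_cong.induct) auto

lemma equiv_word_cong: "equiv (gwords S) (word_cong S R)"
proof (rule equivI)
  show "word_cong S R \<subseteq> gwords S \<times> gwords S"
    using word_cong_gwords by (fastforce simp del: gwords_simps)
  show "refl_on (gwords S) (word_cong S R)"
    by (auto simp: refl_on_def intro: word_cong.refl)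
  show "sym (word_cong S R)" by (meson symI word_cong.sym)
  show "trans (word_cong S R)" by (meson transI word_cong.trans)
qed

lemma word_cong_append_left:
  assumes "(v, w) \<in> word_cong S R" "u \<in> gwords S"
  shows "(u @ v, u @ w) \<in> word_cong S R"
  using assms
proof (induction rule: word_cong.induct)
  case (cancel x v s b)
  then show ?case using word_cong.cancel[of "u @ x" S v s b R] by simp
next
  case (rel x v l r)
  then show ?case using word_cong.rel[of "u @ x" S v l r R] by simp
qed (auto intro: word_cong.intros)

lemma word_cong_append_right:
  assumes "(v, w) \<in> word_cong S R" "u \<in> gwords S"
  shows "(v @ u, w @ u) \<in> word_cong S R"
  using assms
proof (induction rule: word_cong.induct)
  case (cancel x v s b)
  then show ?case using word_cong.cancel[of x S "v @ u" s b R] by simp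
next
  case (rel x v l r)
  then show ?case using word_cong.rel[of x S "v @ u" l r R] by simp
qed (auto intro: word_cong.intros)

lemma word_cong_append:
  assumes "(v, v') \<in> word_cong S R" "(w, w') \<in> word_cong S R"
  shows "(v @ w, v' @ w') \<in> word_cong S R"
  using assms word_cong_append_left word_cong_append_right word_cong_gwords word_cong.trans
  by metis

lemma presented_mult:
  assumes "v \<in> gwords S" "w \<in> gwords S"
  shows "word_cong S R `` {v} \<otimes>\<^bsub>presented_group S R\<^esub> word_cong S R `` {w} = word_cong S R `` {v @ w}"
proof -
  have "congruent2 (word_cong S R) (word_cong S R) (\<lambda>v w. word_cong S R `` {v @ w})"
    by (auto simp: congruent2_def intro!: equiv_class_eq[OF equiv_word_cong] word_cong_append)
  from UN_equiv_class2[OF equiv_word_cong equiv_word_cong this assms] show ?thesis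
    by (simp add: presented_group_def)
qed

lemma presented_carrierE:
  assumes "A \<in> carrier (presented_group S R)"
  obtains w where "w \<in> gwords S" "A = word_cong S R `` {w}"
  using assms by (auto simp: presented_group_def elim: quotientE)

lemma presented_carrierI: "w \<in> gwords S \<Longrightarrow> word_cong S R `` {w} \<in> carrier (presented_group S R)"
  by (auto simp: presented_group_def intro: quotientI)

lemma pgen_in_carrier: "s \<in> S \<Longrightarrow> pgen S R s \<in> carrier (presented_group S R)"
  by (auto simp: pgen_def intro: presented_carrierI)

lemma word_inverse:
  assumes "w \<in> gwords S"
  shows "\<exists>v\<in>gwords S. (v @ w, []) \<in> word_cong S R"
  using assms
proof (induction w)
  case Nil
  then show ?case by (auto intro!: bexI[of _ "[]"] word_cong.refl)
next
  case (Cons x w)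
  then obtain v where v: "v \<in> gwords S" "(v @ w, []) \<in> word_cong S R" by auto
  obtain s b where x: "x = (s, b)" by force
  have "((v @ [(s, \<not> b)]) @ (x # w), v @ w) \<in> word_cong S R"
    using word_cong.cancel[of v S w s "\<not> b" R] v Cons.prems by (simp add: x)
  with v have "((v @ [(s, \<not> b)]) @ (x # w), []) \<in> word_cong S R"
    using word_cong.trans by blast
  with v Cons.prems show ?case
    by (intro bexI[of _ "v @ [(s, \<not> b)]"]) (auto simp: x)
qed

lemma group_presented_group: "group (presented_group S R)"
proof (rule groupI)
  have one: "\<one>\<^bsub>presented_group S R\<^esub> = word_cong S R `` {[]}" by (simp add: presented_group_def)
  show "\<one>\<^bsub>presented_group S R\<^esub> \<in> carrier (presented_group S R)"
    unfolding one by (rule presented_carrierI) simp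
  fix A assume "A \<in> carrier (presented_group S R)"
  then obtain a where a: "a \<in> gwords S" "A = word_cong S R `` {a}" by (rule presented_carrierE)
  show "\<one>\<^bsub>presented_group S R\<^esub> \<otimes>\<^bsub>presented_group S R\<^esub> A = A"
    using a by (simp add: one presented_mult)
  obtain v where v: "v \<in> gwords S" "(v @ a, []) \<in> word_cong S R" using word_inverse a(1) by blast
  then show "\<exists>B\<in>carrier (presented_group S R).
      B \<otimes>\<^bsub>presented_group S R\<^esub> A = \<one>\<^bsub>presented_group S R\<^esub>"
    using a equiv_class_eq[OF equiv_word_cong v(2)]
    by (intro bexI[of _ "word_cong S R `` {v}"]) (simp_all add: one presented_mult presented_carrierI)
  fix B assume "B \<in> carrier (presented_group S R)"
  then obtain b where b: "b \<in> gwords S" "B = word_cong S R `` {b}" by (rule presented_carrierE)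
  show "A \<otimes>\<^bsub>presented_group S R\<^esub> B \<in> carrier (presented_group S R)"
    using a b by (simp add: presented_mult presented_carrierI)
  fix C assume "C \<in> carrier (presented_group S R)"
  then obtain c where c: "c \<in> gwords S" "C = word_cong S R `` {c}" by (rule presented_carrierE)
  show "A \<otimes>\<^bsub>presented_group S R\<^esub> B \<otimes>\<^bsub>presented_group S R\<^esub> C =
      A \<otimes>\<^bsub>presented_group S R\<^esub> (B \<otimes>\<^bsub>presented_group S R\<^esub> C)"
    using a b c by (simp add: presented_mult)
qed

lemma word_eval_closed:
  assumes "group G" "f ` S \<subseteq> carrier G" "w \<in> gwords S"
  shows "word_eval G f w \<in> carrier G"
proof -
  interpret group G by fact
  show ?thesis using assms(2,3) by (induction w) auto
qed

lemma word_eval_append: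
  assumes "group G" "f ` S \<subseteq> carrier G" "v \<in> gwords S" "w \<in> gwords S"
  shows "word_eval G f (v @ w) = word_eval G f v \<otimes>\<^bsub>G\<^esub> word_eval G f w"
proof -
  interpret group G by fact
  note cl = word_eval_closed[OF assms(1,2)]
  show ?thesis using assms(2-4)
  proof (induction v)
    case (Cons x v)
    moreover have "f (fst x) \<in> carrier G" using Cons by auto
    ultimately show ?case by (auto simp: m_assoc cl)
  qed (auto simp: cl)
qed

lemma word_eval_cong:
  assumes "(v, w) \<in> word_cong S R" "group G" "f ` S \<subseteq> carrier G"
    and "\<And>l r. (l, r) \<in> R \<Longrightarrow> word_eval G f l = word_eval G f r"
  shows "word_eval G f v = word_eval G f w"
proof -
  interpret group G by fact
  note cl = word_eval_closed[OF assms(2,3)]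
  note ap = word_eval_append[OF assms(2,3)]
  show ?thesis using assms(1)
  proof (induction rule: word_cong.induct)
    case (cancel u v s b)
    moreover have "f s \<in> carrier G" using assms(3) cancel by auto
    ultimately have "word_eval G f ([(s, b), (s, \<not> b)] @ v) = word_eval G f v"
      by (auto simp: m_assoc[symmetric] cl)
    with cancel show ?case by (simp add: ap del: append.simps word_eval.simps)
  qed (simp_all add: ap assms(4))
qed

lemma presented_lift_class:
  assumes "group G" "f ` S \<subseteq> carrier G" "w \<in> gwords S"
    and "\<And>l r. (l, r) \<in> R \<Longrightarrow> word_eval G f l = word_eval G f r"
  shows "presented_lift S R G f (word_cong S R `` {w}) = word_eval G f w"
proof -
  have "w \<in> word_cong S R `` {w}" using assms(3) by (auto intro: word_cong.refl)
  then have "(SOME v. v \<in> word_cong S R `` {w}) \<in> word_cong S R `` {w}" by (rule someI)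
  then show ?thesis
    using word_eval_cong[of w _ S R G f] assms unfolding presented_lift_def by simp
qed

lemma presented_lift_hom:
  assumes "group G" "f ` S \<subseteq> carrier G"
    and "\<And>l r. (l, r) \<in> R \<Longrightarrow> word_eval G f l = word_eval G f r"
  shows "presented_lift S R G f \<in> hom (presented_group S R) G"
    and "s \<in> S \<Longrightarrow> presented_lift S R G f (pgen S R s) = f s"
proof -
  interpret group G by fact
  note lift = presented_lift_class[OF assms(1,2) _ assms(3)]
  show "presented_lift S R G f \<in> hom (presented_group S R) G"
  proof (rule homI)
    fix A assume "A \<in> carrier (presented_group S R)"
    then obtain a where a: "a \<in> gwords S" "A = word_cong S R `` {a}" by (rule presented_carrierE)
    then show "presented_lift S R G f A \<in> carrier G"
      using lift[of a] word_eval_closed[OF assms(1,2)] by simp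
    fix B assume "B \<in> carrier (presented_group S R)"
    then obtain b where b: "b \<in> gwords S" "B = word_cong S R `` {b}" by (rule presented_carrierE)
    show "presented_lift S R G f (A \<otimes>\<^bsub>presented_group S R\<^esub> B) =
        presented_lift S R G f A \<otimes>\<^bsub>G\<^esub> presented_lift S R G f B"
      using a b lift[of a] lift[of b] lift[of "a @ b"]
      by (simp add: presented_mult word_eval_append[OF assms(1,2)])
  qed
  assume s: "s \<in> S"
  then have "f s \<in> carrier G" using assms(2) by auto
  then show "presented_lift S R G f (pgen S R s) = f s"
    using lift[of "[(s, True)]"] s by (simp add: pgen_def)
qed


section \<open>The virtual braid group and the virtual pure braid group\<close>

datatype vb_gen = Sig nat | Rho nat

definition vb_gens :: "nat \<Rightarrow> vb_gen set"
  where "vb_gens n = Sig ` {1..<n} \<union> Rho ` {1..<n}"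

definition vb_rels :: "nat \<Rightarrow> (vb_gen gword \<times> vb_gen gword) set"
  where "vb_rels n = (let s = (\<lambda>i. (Sig i, True)); r = (\<lambda>i. (Rho i, True)) in
      {([s i, s (i+1), s i], [s (i+1), s i, s (i+1)]) | i. 1 \<le> i \<and> i + 2 \<le> n}
    \<union> {([r i, r (i+1), r i], [r (i+1), r i, r (i+1)]) | i. 1 \<le> i \<and> i + 2 \<le> n}
    \<union> {([r (i+1), s i, r (i+1)], [r i, s (i+1), r i]) | i. 1 \<le> i \<and> i + 2 \<le> n}
    \<union> {([s i, s j], [s j, s i]) | i j. i \<in> {1..<n} \<and> j \<in> {1..<n} \<and> \<bar>int i - int j\<bar> \<ge> 2}
    \<union> {([r i, r j], [r j, r i]) | i j. i \<in> {1..<n} \<and> j \<in> {1..<n} \<and> \<bar>int i - int j\<bar> \<ge> 2}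
    \<union> {([s i, r j], [r j, s i]) | i j. i \<in> {1..<n} \<and> j \<in> {1..<n} \<and> \<bar>int i - int j\<bar> \<ge> 2}
    \<union> {([r i, r i], []) | i. i \<in> {1..<n}})"

definition VB :: "nat \<Rightarrow> vb_gen gword set monoid"
  where "VB n = presented_group (vb_gens n) (vb_rels n)"

definition vb_sigma :: "nat \<Rightarrow> nat \<Rightarrow> vb_gen gword set"
  where "vb_sigma n j = pgen (vb_gens n) (vb_rels n) (Sig j)"

definition vb_rho :: "nat \<Rightarrow> nat \<Rightarrow> vb_gen gword set"
  where "vb_rho n j = pgen (vb_gens n) (vb_rels n) (Rho j)"

definition vb_perm :: "nat \<Rightarrow> vb_gen gword set \<Rightarrow> nat \<Rightarrow> nat"
  where "vb_perm n = presented_lift (vb_gens n) (vb_rels n) (opposite (sym_group n))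
    (\<lambda>g. case g of Sig i \<Rightarrow> transpose i (i+1) | Rho i \<Rightarrow> transpose i (i+1))"

definition VP :: "nat \<Rightarrow> vb_gen gword set set"
  where "VP n = kernel (VB n) (opposite (sym_group n)) (vb_perm n)"

lemma group_VB: "group (VB n)"
  by (simp add: VB_def group_presented_group)

lemma vb_rels_gwords: "vb_rels n \<subseteq> gwords (vb_gens n) \<times> gwords (vb_gens n)"
  by (auto simp: vb_rels_def vb_gens_def Let_def)

lemma transpose_braid:
  "transpose i (Suc i) \<circ> transpose (Suc i) (Suc (Suc i)) \<circ> transpose i (Suc i) =
   transpose (Suc i) (Suc (Suc i)) \<circ> transpose i (Suc i) \<circ> transpose (Suc i) (Suc (Suc i))"
  by (rule ext) (simp add: transpose_def)

lemma transpose_far: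
  assumes "\<bar>int i - int j\<bar> \<ge> 2"
  shows "transpose i (Suc i) \<circ> transpose j (Suc j) = transpose j (Suc j) \<circ> transpose i (Suc i)"
proof -
  have "i \<noteq> j" "Suc i \<noteq> j" "i \<noteq> Suc j" using assms by auto
  then show ?thesis by (intro ext) (auto simp: transpose_def)
qed

lemma vb_perm_hom:
  shows "vb_perm n \<in> hom (VB n) (opposite (sym_group n))"
    and "j \<in> {1..<n} \<Longrightarrow> vb_perm n (vb_sigma n j) = transpose j (j+1)"
    and "j \<in> {1..<n} \<Longrightarrow> vb_perm n (vb_rho n j) = transpose j (j+1)"
proof -
  let ?f = "\<lambda>g. case g of Sig i \<Rightarrow> transpose i (i+1) | Rho i \<Rightarrow> transpose i (i+1)"
  have G: "group (opposite (sym_group n))"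
    by (rule group_opposite[OF sym_group_is_group])
  have f: "?f ` vb_gens n \<subseteq> carrier (opposite (sym_group n))"
    by (auto simp: vb_gens_def sym_group_carrier intro!: permutes_swap_id)
  have rel: "word_eval (opposite (sym_group n)) ?f l = word_eval (opposite (sym_group n)) ?f r"
    if "(l, r) \<in> vb_rels n" for l r
    using that
    by (auto simp: vb_rels_def Let_def sym_group_mult sym_group_one transpose_braid transpose_far)
  show "vb_perm n \<in> hom (VB n) (opposite (sym_group n))"
    unfolding vb_perm_def VB_def by (rule presented_lift_hom(1)[OF G f rel])
  show "vb_perm n (vb_sigma n j) = transpose j (j+1)" if "j \<in> {1..<n}"
    unfolding vb_perm_def vb_sigma_def
    using presented_lift_hom(2)[where s = "Sig j", OF G f rel] that by (simp add: vb_gens_def)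
  show "vb_perm n (vb_rho n j) = transpose j (j+1)" if "j \<in> {1..<n}"
    unfolding vb_perm_def vb_rho_def
    using presented_lift_hom(2)[where s = "Rho j", OF G f rel] that by (simp add: vb_gens_def)
qed


section \<open>Laurent polynomials\<close>

text \<open>A monomial is a finitely supported family of integer exponents, and a Laurent polynomial is a
  finitely supported family of integer coefficients indexed by monomials. The type below has the
  variables \<open>t\<^sub>k, q\<^sub>k\<close> for all \<open>k\<close>; the ring \<open>Kring n\<close> consists of those elements in which only
  the variables with \<open>1 \<le> k \<le> n\<close> occur.\<close>

datatype 'i lvar = T 'i | Q 'i

type_synonym laurent = "(nat lvar \<Rightarrow>\<^sub>0 int) \<Rightarrow>\<^sub>0 int"

definition lpow :: "nat lvar \<Rightarrow> int \<Rightarrow> laurent"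
  where "lpow x e = Poly_Mapping.single (Poly_Mapping.single x e) 1"

abbreviation tvar :: "nat \<Rightarrow> laurent" where "tvar k \<equiv> lpow (T k) 1"
abbreviation qvar :: "nat \<Rightarrow> laurent" where "qvar k \<equiv> lpow (Q k) 1"
abbreviation qvar_inv :: "nat \<Rightarrow> laurent" where "qvar_inv k \<equiv> lpow (Q k) (-1)"

lemma lpow_0: "lpow x 0 = 1"
  by (simp add: lpow_def)

lemma lpow_add: "lpow x (a + b) = lpow x a * lpow x b"
  by (simp add: lpow_def mult_single single_add)

definition Kset :: "nat \<Rightarrow> laurent set"
  where "Kset n = {p. \<forall>m\<in>Poly_Mapping.keys p. Poly_Mapping.keys m \<subseteq> T ` {1..n} \<union> Q ` {1..n}}"

definition Kring :: "nat \<Rightarrow> laurent ring"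
  where "Kring n = \<lparr>carrier = Kset n, monoid.mult = (*), one = 1, ring.zero = 0, add = (+)\<rparr>"

text \<open>For an injection \<open>\<tau>\<close>, \<open>map_key \<tau>\<close> precomposes a family with \<open>\<tau>\<close>. The swap of variables is an
  involution, so precomposing with it is the same as renaming along it.\<close>

definition swap_var :: "nat \<Rightarrow> nat lvar \<Rightarrow> nat lvar"
  where "swap_var j = map_lvar (transpose j (j+1))"

definition swapK :: "nat \<Rightarrow> laurent \<Rightarrow> laurent"
  where "swapK j = Poly_Mapping.map_key (Poly_Mapping.map_key (swap_var j))"

lemma swap_var_simps [simp]:
  "swap_var j (T k) = T (transpose j (j+1) k)" "swap_var j (Q k) = Q (transpose j (j+1) k)"
  by (simp_all add: swap_var_def)

lemma swap_var_swap_var [simp]: "swap_var j (swap_var j x) = x"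
  by (cases x) simp_all

lemma inj_swap_var: "inj (swap_var j)"
  by (metis injI swap_var_swap_var)

lemma map_key_swap_var [simp]:
  "Poly_Mapping.map_key (swap_var j) (Poly_Mapping.map_key (swap_var j) m) = m"
  by (rule poly_mapping_eqI) (simp add: Poly_Mapping.map_key.rep_eq inj_swap_var)

lemma inj_map_key_swap_var: "inj (Poly_Mapping.map_key (swap_var j) :: (nat lvar \<Rightarrow>\<^sub>0 int) \<Rightarrow> _)"
  by (metis injI map_key_swap_var)

lemma swapK_swapK [simp]: "swapK j (swapK j p) = p"
  unfolding swapK_def
  by (rule poly_mapping_eqI) (simp add: Poly_Mapping.map_key.rep_eq inj_map_key_swap_var)

lemma swapK_add: "swapK j (p + q) = swapK j p + swapK j q"
  by (simp add: swapK_def map_key_plus inj_map_key_swap_var)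

lemma swapK_0 [simp]: "swapK j 0 = 0"
  by (simp add: swapK_def map_key_zero inj_map_key_swap_var)

lemma swapK_sum: "swapK j (sum f A) = (\<Sum>a\<in>A. swapK j (f a))"
  by (induction A rule: infinite_finite_induct) (simp_all add: swapK_add)

lemma swapK_single:
  "swapK j (Poly_Mapping.single m c) = Poly_Mapping.single (Poly_Mapping.map_key (swap_var j) m) c"
  unfolding swapK_def
  using map_key_single[OF inj_map_key_swap_var, of j "Poly_Mapping.map_key (swap_var j) m" c] by simp

lemma poly_mapping_sum_monomials:
  "(\<Sum>m\<in>Poly_Mapping.keys p. Poly_Mapping.single m (Poly_Mapping.lookup p m)) = p"
  by (rule poly_mapping_eqI) (auto simp: lookup_sum lookup_single when_def in_keys_iff)

lemma swapK_mult: "swapK j (p * q) = swapK j p * swapK j q"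
proof -
  have single: "swapK j (Poly_Mapping.single m c * Poly_Mapping.single m' c') =
      swapK j (Poly_Mapping.single m c) * swapK j (Poly_Mapping.single m' c')" for m m' c c'
    by (simp add: mult_single swapK_single map_key_plus inj_swap_var)
  have "swapK j ((\<Sum>m\<in>Poly_Mapping.keys p. Poly_Mapping.single m (Poly_Mapping.lookup p m)) *
        (\<Sum>m\<in>Poly_Mapping.keys q. Poly_Mapping.single m (Poly_Mapping.lookup q m))) =
      swapK j (\<Sum>m\<in>Poly_Mapping.keys p. Poly_Mapping.single m (Poly_Mapping.lookup p m)) *
      swapK j (\<Sum>m\<in>Poly_Mapping.keys q. Poly_Mapping.single m (Poly_Mapping.lookup q m))"
    by (simp only: sum_product swapK_sum single)
  then show ?thesis by (simp only: poly_mapping_sum_monomials)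
qed

lemma swapK_lpow: "swapK j (lpow x e) = lpow (swap_var j x) e"
proof -
  have "Poly_Mapping.map_key (swap_var j) (Poly_Mapping.single x e) =
      Poly_Mapping.single (swap_var j x) e"
    using map_key_single[OF inj_swap_var, of j "swap_var j x" e] by simp
  then show ?thesis by (simp add: lpow_def swapK_single)
qed

lemma swapK_1 [simp]: "swapK j 1 = 1"
  using swapK_lpow[of j "T 0" 0] by (simp add: lpow_0)

lemma swapK_closed:
  assumes "j \<in> {1..<n}" "p \<in> Kset n" shows "swapK j p \<in> Kset n"
proof -
  have *: "x \<in> T ` {1..n} \<union> Q ` {1..n}" if "swap_var j x \<in> T ` {1..n} \<union> Q ` {1..n}" for x
    using that assms(1) by (cases x) (auto simp: transpose_def split: if_splits)
  have "x \<in> T ` {1..n} \<union> Q ` {1..n}"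
    if "m \<in> Poly_Mapping.keys (swapK j p)" and x: "x \<in> Poly_Mapping.keys m" for m x
  proof -
    from that(1)
    have "Poly_Mapping.map_key (swap_var j) m \<in> Poly_Mapping.keys p"
      by (simp add: swapK_def keys_map_key inj_map_key_swap_var)
    then have "Poly_Mapping.keys (Poly_Mapping.map_key (swap_var j) m) \<subseteq> T ` {1..n} \<union> Q ` {1..n}"
      using assms(2) by (simp add: Kset_def)
    moreover have "swap_var j x \<in> Poly_Mapping.keys (Poly_Mapping.map_key (swap_var j) m)"
      using x by (simp add: keys_map_key inj_swap_var)
    ultimately have "swap_var j x \<in> T ` {1..n} \<union> Q ` {1..n}" by blast
    from *[OF this] show ?thesis .
  qed
  then show ?thesis unfolding Kset_def by blast
qed

lemma swapK_ring_iso: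
  assumes "j \<in> {1..<n}" shows "swapK j \<in> ring_iso (Kring n) (Kring n)"
proof -
  have "bij_betw (swapK j) (Kset n) (Kset n)"
    using swapK_closed[OF assms] by (intro bij_betw_byWitness[where f' = "swapK j"]) auto
  then show ?thesis
    using swapK_closed[OF assms] by (auto simp: ring_iso_def ring_hom_def Kring_def swapK_add swapK_mult)
qed

lemma Kset_0 [simp]: "0 \<in> Kset n"
  by (simp add: Kset_def)

lemma Kset_1 [simp]: "1 \<in> Kset n"
proof -
  have "Poly_Mapping.single 0 1 \<in> Kset n" by (simp add: Kset_def)
  then show ?thesis by simp
qed

lemma Kset_add [simp]: "p \<in> Kset n \<Longrightarrow> q \<in> Kset n \<Longrightarrow> p + q \<in> Kset n"
  using keys_add[of p q] by (force simp: Kset_def)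

lemma Kset_uminus [simp]: "p \<in> Kset n \<Longrightarrow> - p \<in> Kset n"
  by (auto simp: Kset_def in_keys_iff)

lemma Kset_mult [simp]:
  assumes "p \<in> Kset n" "q \<in> Kset n" shows "p * q \<in> Kset n"
proof -
  have "Poly_Mapping.keys m \<subseteq> T ` {1..n} \<union> Q ` {1..n}" if "m \<in> Poly_Mapping.keys (p * q)" for m
  proof -
    from that obtain a b where ab: "m = a + b" "a \<in> Poly_Mapping.keys p" "b \<in> Poly_Mapping.keys q"
      using keys_mult[of p q] by blast
    have "Poly_Mapping.keys m \<subseteq> Poly_Mapping.keys a \<union> Poly_Mapping.keys b"
      unfolding ab(1) by (rule keys_add)
    with ab assms show ?thesis unfolding Kset_def by blast
  qed
  then show ?thesis by (simp add: Kset_def)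
qed

lemma cring_Kring: "cring (Kring n)"
proof (rule cringI)
  show "abelian_group (Kring n)"
    by (rule abelian_groupI) (auto simp: Kring_def algebra_simps intro!: bexI[of _ "- _"])
  show "comm_monoid (Kring n)"
    by (rule comm_monoidI) (auto simp: Kring_def algebra_simps)
qed (auto simp: Kring_def algebra_simps)


section \<open>The free module and the automorphisms of its additive group\<close>

text \<open>\<open>Kmod n\<close> is the standard model of the free module with basis \<open>evec 1, \<dots>, evec n\<close>: functions that
  vanish outside \<open>{1..n}\<close>. The multiplicative fields of the record are irrelevant for a module.\<close>

definition Kmod :: "nat \<Rightarrow> (laurent, nat \<Rightarrow> laurent) module"
  where "Kmod n =
    \<lparr>carrier = {v. (\<forall>k\<in>{1..n}. v k \<in> carrier (Kring n)) \<and> (\<forall>k. k \<notin> {1..n} \<longrightarrow> v k = 0)},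
     monoid.mult = undefined, one = undefined,
     ring.zero = (\<lambda>_. 0), add = (\<lambda>u v k. u k + v k), smult = (\<lambda>a v k. a * v k)\<rparr>"

definition evec :: "nat \<Rightarrow> nat \<Rightarrow> laurent"
  where "evec k = (\<lambda>i. if i = k then 1 else 0)"

lemma module_Kmod: "module (Kring n) (Kmod n)"
proof (rule moduleI[OF cring_Kring])
  show "abelian_group (Kmod n)"
  proof (rule abelian_groupI)
    fix v assume "v \<in> carrier (Kmod n)"
    then show "\<exists>w\<in>carrier (Kmod n). w \<oplus>\<^bsub>Kmod n\<^esub> v = \<zero>\<^bsub>Kmod n\<^esub>"
      by (intro bexI[of _ "\<lambda>k. - v k"]) (auto simp: Kmod_def Kring_def)
  qed (auto simp: Kmod_def Kring_def algebra_simps)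
qed (auto simp: Kmod_def Kring_def algebra_simps)

lemma evec_closed: "k \<in> {1..n} \<Longrightarrow> evec k \<in> carrier (Kmod n)"
  by (auto simp: Kmod_def Kring_def evec_def)

lemma finsum_Kmod:
  assumes "finite A" "\<And>a. a \<in> A \<Longrightarrow> f a \<in> carrier (Kmod n)"
  shows "(\<Oplus>\<^bsub>Kmod n\<^esub>a\<in>A. f a) = (\<lambda>i. \<Sum>a\<in>A. f a i)"
proof -
  interpret module "Kring n" "Kmod n" by (rule module_Kmod)
  show ?thesis using assms
  proof (induction A rule: finite_induct)
    case empty
    show ?case by (simp only: M.finsum_empty) (simp add: Kmod_def)
  next
    case (insert a A)
    then have "finsum (Kmod n) f (insert a A) = f a \<oplus>\<^bsub>Kmod n\<^esub> finsum (Kmod n) f A"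
      by (intro M.finsum_insert) auto
    with insert show ?case by (simp add: Kmod_def)
  qed
qed

lemma evec_basis:
  assumes "v \<in> carrier (Kmod n)"
  shows "v = (\<Oplus>\<^bsub>Kmod n\<^esub>k\<in>{1..n}. v k \<odot>\<^bsub>Kmod n\<^esub> evec k)"
proof -
  have "(\<Oplus>\<^bsub>Kmod n\<^esub>k\<in>{1..n}. v k \<odot>\<^bsub>Kmod n\<^esub> evec k) = (\<lambda>i. \<Sum>k\<in>{1..n}. (v k \<odot>\<^bsub>Kmod n\<^esub> evec k) i)"
    using assms by (intro finsum_Kmod) (auto simp: Kmod_def Kring_def evec_def)
  also have "\<dots> = v"
    using assms by (auto simp: Kmod_def evec_def fun_eq_iff if_distrib cong: if_cong)
  finally show ?thesis by simp
qed

definition AutX :: "nat \<Rightarrow> ((nat \<Rightarrow> laurent) \<Rightarrow> (nat \<Rightarrow> laurent)) monoid"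
  where "AutX n = opposite (AutoGroup (add_monoid (Kmod n)))"

definition GL :: "nat \<Rightarrow> ((nat \<Rightarrow> laurent) \<Rightarrow> (nat \<Rightarrow> laurent)) monoid"
  where "GL n = (AutX n)\<lparr>carrier := {f \<in> carrier (AutX n).
    \<forall>a\<in>carrier (Kring n). \<forall>v\<in>carrier (Kmod n). f (a \<odot>\<^bsub>Kmod n\<^esub> v) = a \<odot>\<^bsub>Kmod n\<^esub> f v}\<rparr>"

definition R_basis :: "nat \<Rightarrow> nat \<Rightarrow> nat \<Rightarrow> nat \<Rightarrow> laurent"
  where "R_basis n j k =
    (if k = j then (1 - tvar (j+1)) \<odot>\<^bsub>Kmod n\<^esub> evec j \<oplus>\<^bsub>Kmod n\<^esub> tvar j \<odot>\<^bsub>Kmod n\<^esub> evec (j+1)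
     else if k = j + 1 then evec j
     else evec k)"

definition G_basis :: "nat \<Rightarrow> nat \<Rightarrow> nat \<Rightarrow> nat \<Rightarrow> laurent"
  where "G_basis n j k =
    (if k = j then qvar j \<odot>\<^bsub>Kmod n\<^esub> evec (j+1)
     else if k = j + 1 then qvar_inv (j+1) \<odot>\<^bsub>Kmod n\<^esub> evec j
     else evec k)"

text \<open>Elements of \<open>AutoGroup\<close> are extensional, hence the restriction to the carrier.\<close>

definition Rmap :: "nat \<Rightarrow> nat \<Rightarrow> (nat \<Rightarrow> laurent) \<Rightarrow> (nat \<Rightarrow> laurent)"
  where "Rmap n j = (\<lambda>\<alpha>\<in>carrier (Kmod n). \<Oplus>\<^bsub>Kmod n\<^esub>k\<in>{1..n}. swapK j (\<alpha> k) \<odot>\<^bsub>Kmod n\<^esub> R_basis n j k)"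

definition Gmap :: "nat \<Rightarrow> nat \<Rightarrow> (nat \<Rightarrow> laurent) \<Rightarrow> (nat \<Rightarrow> laurent)"
  where "Gmap n j = (\<lambda>\<alpha>\<in>carrier (Kmod n). \<Oplus>\<^bsub>Kmod n\<^esub>k\<in>{1..n}. swapK j (\<alpha> k) \<odot>\<^bsub>Kmod n\<^esub> G_basis n j k)"

definition extends_phi3B ::
    "nat \<Rightarrow> (vb_gen gword set \<Rightarrow> (nat \<Rightarrow> laurent) \<Rightarrow> (nat \<Rightarrow> laurent)) \<Rightarrow> bool"
  where "extends_phi3B n \<phi> \<longleftrightarrow> \<phi> \<in> hom (VB n) (AutX n) \<and>
    (\<forall>j\<in>{1..<n}. \<phi> (vb_sigma n j) = Rmap n j \<and> \<phi> (vb_rho n j) = Gmap n j)"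

end

theory Submission
  imports Defs
begin

text \<open>Written in coordinates, the maps \<open>R\<^sub>j\<close> and \<open>G\<^sub>j\<close> are explicit, and each defining relation of
  the virtual braid group becomes a polynomial identity in every coordinate. Both generators with
  index \<open>j\<close> act semilinearly over the transposition of \<open>j\<close> and \<open>j + 1\<close> of the variables, which is also
  their image in the symmetric group. Hence the image of any \<open>A\<close> is semilinear over the permutation of
  the variables given by \<open>A\<close>, and it is linear if that permutation is trivial.\<close>

section \<open>Homomorphisms out of presented groups\<close>

lemma presented_inv_pgen:
  assumes "s \<in> S"
  shows "inv\<^bsub>presented_group S R\<^esub> (pgen S R s) = word_cong S R `` {[(s, False)]}"
proof (rule group.inv_equality[OF group_presented_group])
  have "([(s, False), (s, True)], []) \<in> word_cong S R"
    using word_cong.cancel[of "[]" S "[]" s False R] assms by simp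
  then show "word_cong S R `` {[(s, False)]} \<otimes>\<^bsub>presented_group S R\<^esub> pgen S R s =
      \<one>\<^bsub>presented_group S R\<^esub>"
    using assms equiv_class_eq[OF equiv_word_cong]
    by (simp add: pgen_def presented_mult) (simp add: presented_group_def)
qed (use assms in \<open>auto intro: pgen_in_carrier presented_carrierI\<close>)

text \<open>A homomorphism is determined by its values on the generators. Besides uniqueness, this
  allows \<open>\<phi>\<close> and \<open>vb_perm\<close> to be computed along one and the same
  word.\<close>

lemma presented_hom_eval:
  assumes "group G" and h: "h \<in> hom (presented_group S R) G" and "w \<in> gwords S"
  shows "h (word_cong S R `` {w}) = word_eval G (\<lambda>s. h (pgen S R s)) w"
proof -
  interpret group_hom "presented_group S R" G h
    using assms group_presented_group by (simp add: group_hom_def group_hom_axioms_def)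
  show ?thesis using assms(3)
  proof (induction w)
    case Nil
    have "word_cong S R `` {[]} = \<one>\<^bsub>presented_group S R\<^esub>"
      by (simp add: presented_group_def)
    then show ?case by (simp only: hom_one word_eval.simps)
  next
    case (Cons x w)
    obtain s b where x: "x = (s, b)" by force
    have s: "s \<in> S" "w \<in> gwords S" using Cons.prems x by auto
    have "word_cong S R `` {x # w} =
        word_cong S R `` {[x]} \<otimes>\<^bsub>presented_group S R\<^esub> word_cong S R `` {w}"
      using s x by (simp add: presented_mult)
    then have "h (word_cong S R `` {x # w}) = h (word_cong S R `` {[x]}) \<otimes>\<^bsub>G\<^esub> h (word_cong S R `` {w})"
      using s x by (simp add: presented_carrierI)
    moreover have "h (word_cong S R `` {[x]}) = (if b then h (pgen S R s) else inv\<^bsub>G\<^esub> h (pgen S R s))"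
    proof (cases b)
      case False
      have "h (inv\<^bsub>presented_group S R\<^esub> (pgen S R s)) = inv\<^bsub>G\<^esub> h (pgen S R s)"
        by (rule hom_inv[OF pgen_in_carrier[OF s(1)]])
      with False x show ?thesis by (simp add: presented_inv_pgen[OF s(1)])
    qed (simp add: x pgen_def)
    ultimately show ?case using Cons.IH s x by simp
  qed
qed

lemma word_eval_fun_cong:
  "w \<in> gwords S \<Longrightarrow> (\<And>s. s \<in> S \<Longrightarrow> f s = g s) \<Longrightarrow> word_eval G f w = word_eval G g w"
  by (induction w) auto

lemma presented_hom_unique:
  assumes "group G" "h \<in> hom (presented_group S R) G" "k \<in> hom (presented_group S R) G"
    and "\<And>s. s \<in> S \<Longrightarrow> h (pgen S R s) = k (pgen S R s)"
    and "A \<in> carrier (presented_group S R)"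
  shows "h A = k A"
proof -
  from assms(5) obtain w where w: "w \<in> gwords S" "A = word_cong S R `` {w}"
    by (rule presented_carrierE)
  then show ?thesis
    using presented_hom_eval[OF assms(1,2) w(1)] presented_hom_eval[OF assms(1,3) w(1)]
      word_eval_fun_cong[OF w(1) assms(4)] by simp
qed

section \<open>Permutations of the variables\<close>

text \<open>Each \<open>map_key\<close> is a precomposition and thus contravariant; nesting two of them makes \<open>permK p\<close>
  send the variable with index \<open>k\<close> to the one with index \<open>p k\<close>.\<close>

definition permK :: "(nat \<Rightarrow> nat) \<Rightarrow> laurent \<Rightarrow> laurent"
  where "permK p = Poly_Mapping.map_key (Poly_Mapping.map_key (map_lvar p))"

text \<open>Precomposition with \<open>f\<close> is injective because \<open>f\<close> is onto;
  injectivity of \<open>f\<close> is what makes \<open>map_key f\<close> a precomposition at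
  all.\<close>

lemma inj_map_key_bij:
  assumes "bij f" shows "inj (Poly_Mapping.map_key f :: ('a \<Rightarrow>\<^sub>0 int) \<Rightarrow> _)"
proof (rule injI)
  fix x y :: "'a \<Rightarrow>\<^sub>0 int"
  assume "Poly_Mapping.map_key f x = Poly_Mapping.map_key f y"
  then have "Poly_Mapping.lookup x (f z) = Poly_Mapping.lookup y (f z)" for z
    using bij_is_inj[OF assms] by (metis map_key.rep_eq comp_apply)
  then show "x = y" using bij_is_surj[OF assms] by (intro poly_mapping_eqI) (metis surjD)
qed

lemma bij_map_lvar: "bij p \<Longrightarrow> bij (map_lvar p)"
  by (rule o_bij[of "map_lvar (inv' p)"])
    (simp_all add: fun_eq_iff lvar.map_comp o_def lvar.map_ident bij_is_inj bij_is_surj surj_f_inv_f)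

text \<open>Both levels of \<open>map_key\<close> reverse the order of composition, and the two
  reversals cancel.\<close>

lemma permK_comp:
  assumes "bij p" "bij p'" shows "permK p (permK p' a) = permK (p \<circ> p') a"
proof -
  have "Poly_Mapping.map_key (map_lvar p') \<circ> Poly_Mapping.map_key (map_lvar p) =
      (Poly_Mapping.map_key (map_lvar (p \<circ> p')) :: (nat lvar \<Rightarrow>\<^sub>0 int) \<Rightarrow> _)"
    using assms by (simp add: fun_eq_iff map_key_compose bij_map_lvar bij_is_inj lvar.map_comp o_def)
  then show ?thesis
    using assms by (simp add: permK_def map_key_compose bij_map_lvar inj_map_key_bij)
qed

lemma map_key_id_eq_id: "Poly_Mapping.map_key id = id"
  by (rule ext) (simp add: id_def map_key_id)

lemma permK_id: "permK id = id"
  by (simp only: permK_def lvar.map_id0 map_key_id_eq_id)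

lemma swapK_eq_permK: "swapK j = permK (transpose j (j + 1))"
  by (simp add: fun_eq_iff swapK_def permK_def swap_var_def)

text \<open>Relations among swaps of variables are inherited from transpositions of indices, because
  \<open>permK\<close> respects composition of bijections.\<close>

lemma swapK_braid:
  "swapK j (swapK (Suc j) (swapK j a)) = swapK (Suc j) (swapK j (swapK (Suc j) a))"
  using transpose_braid[of j] by (simp add: swapK_eq_permK permK_comp bij_comp flip: o_assoc)

lemma swapK_far:
  "\<bar>int i - int j\<bar> \<ge> 2 \<Longrightarrow> swapK i (swapK j a) = swapK j (swapK i a)"
  using transpose_far[of i j] by (simp add: swapK_eq_permK permK_comp)

section \<open>Differences, inverse variables and closure in the Laurent ring\<close>

lemma swapK_diff: "swapK j (a - b) = swapK j a - swapK j b"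
  by (metis add_diff_cancel_right' diff_add_cancel swapK_add)

lemma lpow_inverse: "lpow x 1 * lpow x (- 1) = 1" "lpow x (- 1) * lpow x 1 = 1"
  by (simp_all add: lpow_0 flip: lpow_add)

lemma lpow_inverse_left:
  "lpow x 1 * (lpow x (- 1) * a) = a" "lpow x (- 1) * (lpow x 1 * a) = a"
  by (simp_all add: lpow_inverse flip: mult.assoc)

lemma Kset_diff: "a \<in> Kset n \<Longrightarrow> b \<in> Kset n \<Longrightarrow> a - b \<in> Kset n"
  by (metis Kset_add Kset_uminus diff_conv_add_uminus)

lemma lpow_closed: "x \<in> T ` {1..n} \<union> Q ` {1..n} \<Longrightarrow> lpow x e \<in> Kset n"
  by (auto simp: lpow_def Kset_def split: if_splits)

section \<open>The generators in coordinates\<close>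

text \<open>The value of \<open>Rmap\<close> gathered by basis vector. The operator acts on all
  families, without mention of \<open>n\<close>, so the relations become plain equations free of
  closure conditions.\<close>

definition Rop :: "nat \<Rightarrow> (nat \<Rightarrow> laurent) \<Rightarrow> nat \<Rightarrow> laurent"
  where "Rop j \<alpha> i =
    (if i = j then (1 - tvar (Suc j)) * swapK j (\<alpha> j) + swapK j (\<alpha> (Suc j))
     else if i = Suc j then tvar j * swapK j (\<alpha> j)
     else swapK j (\<alpha> i))"

text \<open>Found by solving for the argument: coordinate \<open>Suc j\<close> of the image yields
  the old coordinate \<open>j\<close>, where the swap turns the inverse of \<open>tvar j\<close>
  into that of \<open>tvar (Suc j)\<close>; coordinate \<open>j\<close> then yields the old
  coordinate \<open>Suc j\<close>.\<close>

definition Rop_inv :: "nat \<Rightarrow> (nat \<Rightarrow> laurent) \<Rightarrow> nat \<Rightarrow> laurent"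
  where "Rop_inv j \<alpha> i =
    (if i = j then lpow (T (Suc j)) (-1) * swapK j (\<alpha> (Suc j))
     else if i = Suc j then swapK j (\<alpha> j) - (1 - tvar j) * lpow (T (Suc j)) (-1) * swapK j (\<alpha> (Suc j))
     else swapK j (\<alpha> i))"

definition Gop :: "nat \<Rightarrow> (nat \<Rightarrow> laurent) \<Rightarrow> nat \<Rightarrow> laurent"
  where "Gop j \<alpha> i =
    (if i = j then qvar_inv (Suc j) * swapK j (\<alpha> (Suc j))
     else if i = Suc j then qvar j * swapK j (\<alpha> j)
     else swapK j (\<alpha> i))"

lemmas swapK_distribs = swapK_add swapK_diff swapK_mult swapK_lpow

lemma Rop_Rop_inv: "Rop j (Rop_inv j \<alpha>) = \<alpha>"
  by (rule ext) (auto simp: Rop_def Rop_inv_def swapK_distribs lpow_inverse lpow_inverse_left algebra_simps)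

lemma Rop_inv_Rop: "Rop_inv j (Rop j \<alpha>) = \<alpha>"
  by (rule ext) (auto simp: Rop_def Rop_inv_def swapK_distribs lpow_inverse lpow_inverse_left algebra_simps)

text \<open>The inner weight, once swapped, is inverse to the outer one: \<open>qvar j\<close>
  becomes \<open>qvar (Suc j)\<close> and meets \<open>qvar_inv (Suc j)\<close>, and symmetrically
  in the other coordinate.\<close>

lemma Gop_Gop: "Gop j (Gop j \<alpha>) = \<alpha>"
  by (rule ext) (auto simp: Gop_def swapK_distribs lpow_inverse_left)

text \<open>Pushing the swaps inwards permutes the variables in the coefficients and leaves three
  swaps on each coordinate of \<alpha>. These agree by \<open>swapK_braid\<close>, and a polynomial
  identity remains.\<close>

lemma Rop_braid: "Rop j (Rop (Suc j) (Rop j \<alpha>)) = Rop (Suc j) (Rop j (Rop (Suc j) \<alpha>))"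
  by (rule ext) (auto simp: Rop_def swapK_distribs swapK_braid algebra_simps transpose_def)

lemma Gop_braid: "Gop j (Gop (Suc j) (Gop j \<alpha>)) = Gop (Suc j) (Gop j (Gop (Suc j) \<alpha>))"
  by (rule ext) (auto simp: Gop_def swapK_distribs swapK_braid algebra_simps transpose_def)

text \<open>Here inverse weights must cancel: in coordinate \<open>j\<close>, the right-hand side
  multiplies the term from \<alpha> at \<open>j\<close> by \<open>qvar (Suc j)\<close> and its
  inverse, while the left-hand side gives that term no such weight.\<close>

lemma Gop_Rop_Gop: "Gop (Suc j) (Rop j (Gop (Suc j) \<alpha>)) = Gop j (Rop (Suc j) (Gop j \<alpha>))"
  by (rule ext) (auto simp: Rop_def Gop_def swapK_distribs swapK_braid algebra_simps transpose_def
      lpow_inverse_left)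

text \<open>The affected coordinates are disjoint, and the swap belonging to one operator also fixes
  the variables in the coefficients of the other.\<close>

lemma op_far:
  assumes "\<bar>int i - int j\<bar> \<ge> 2"
  shows "Rop i (Rop j \<alpha>) = Rop j (Rop i \<alpha>)"
    and "Gop i (Gop j \<alpha>) = Gop j (Gop i \<alpha>)"
    and "Rop i (Gop j \<alpha>) = Gop j (Rop i \<alpha>)"
proof -
  have "i \<noteq> j" "j \<noteq> i" "Suc i \<noteq> j" "i \<noteq> Suc j" "j \<noteq> Suc i" "Suc j \<noteq> i" using assms by auto
  note * = this Rop_def Gop_def swapK_distribs swapK_far[OF assms] transpose_def
  show "Rop i (Rop j \<alpha>) = Rop j (Rop i \<alpha>)" "Gop i (Gop j \<alpha>) = Gop j (Gop i \<alpha>)"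
    "Rop i (Gop j \<alpha>) = Gop j (Rop i \<alpha>)"
    by (rule ext, auto simp: *)+
qed

section \<open>Agreement of the coordinate formulas with the defining sums\<close>

lemma carrier_Kmod:
  "v \<in> carrier (Kmod n) \<longleftrightarrow> (\<forall>k\<in>{1..n}. v k \<in> Kset n) \<and> (\<forall>k. k \<notin> {1..n} \<longrightarrow> v k = 0)"
  by (simp add: Kmod_def Kring_def)

lemma op_closed:
  assumes "j \<in> {1..<n}" "\<alpha> \<in> carrier (Kmod n)"
  shows "Rop j \<alpha> \<in> carrier (Kmod n)" "Rop_inv j \<alpha> \<in> carrier (Kmod n)" "Gop j \<alpha> \<in> carrier (Kmod n)"
proof -
  have j: "1 \<le> j" "j < n" "j \<in> {1..n}" "Suc j \<in> {1..n}" using assms(1) by auto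
  have "swapK j (\<alpha> k) \<in> Kset n" if "k \<in> {1..n}" for k
    using swapK_closed[OF assms(1)] assms(2) that unfolding carrier_Kmod by blast
  moreover have "swapK j (\<alpha> k) = 0" if "k \<notin> {1..n}" for k
    using assms(2) that unfolding carrier_Kmod by simp
  ultimately show "Rop j \<alpha> \<in> carrier (Kmod n)" "Rop_inv j \<alpha> \<in> carrier (Kmod n)"
    "Gop j \<alpha> \<in> carrier (Kmod n)"
    using j by (auto simp: carrier_Kmod Rop_def Rop_inv_def Gop_def intro!: lpow_closed Kset_add Kset_diff Kset_mult)
qed

text \<open>Serves both families of generators: each moves only two basis vectors, so only their
  images are left open.\<close>

lemma sum_basis_expand:
  assumes j: "j \<in> {1..<n}" and \<alpha>: "\<alpha> \<in> carrier (Kmod n)"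
    and B: "\<And>k. k \<in> {1..n} \<Longrightarrow> B k \<in> carrier (Kmod n)"
    and B_other: "\<And>k. k \<noteq> j \<Longrightarrow> k \<noteq> Suc j \<Longrightarrow> B k = evec k"
  shows "(\<Oplus>\<^bsub>Kmod n\<^esub>k\<in>{1..n}. swapK j (\<alpha> k) \<odot>\<^bsub>Kmod n\<^esub> B k) =
    (\<lambda>i. swapK j (\<alpha> j) * B j i + swapK j (\<alpha> (Suc j)) * B (Suc j) i +
      (if i = j \<or> i = Suc j then 0 else swapK j (\<alpha> i)))"
proof -
  interpret module "Kring n" "Kmod n" by (rule module_Kmod)
  have sw: "swapK j (\<alpha> k) \<in> carrier (Kring n)" if "k \<in> {1..n}" for k
    using swapK_closed[OF j] \<alpha> that unfolding carrier_Kmod by (simp add: Kring_def)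
  have "(\<Oplus>\<^bsub>Kmod n\<^esub>k\<in>{1..n}. swapK j (\<alpha> k) \<odot>\<^bsub>Kmod n\<^esub> B k) =
      (\<lambda>i. \<Sum>k\<in>{1..n}. (swapK j (\<alpha> k) \<odot>\<^bsub>Kmod n\<^esub> B k) i)"
    by (rule finsum_Kmod) (use B sw in auto)
  also have "\<dots> = (\<lambda>i. \<Sum>k\<in>{1..n}. swapK j (\<alpha> k) * B k i)"
    by (simp add: Kmod_def)
  also have "\<dots> = (\<lambda>i. swapK j (\<alpha> j) * B j i + swapK j (\<alpha> (Suc j)) * B (Suc j) i +
      (\<Sum>k\<in>{1..n} - {j, Suc j}. swapK j (\<alpha> k) * B k i))"
    using j by (intro ext) (subst sum.subset_diff[of "{j, Suc j}" "{1..n}"], auto)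
  also have "\<dots> = (\<lambda>i. swapK j (\<alpha> j) * B j i + swapK j (\<alpha> (Suc j)) * B (Suc j) i +
      (\<Sum>k\<in>{1..n} - {j, Suc j}. if i = k then swapK j (\<alpha> k) else 0))"
    by (intro ext arg_cong2[where f = "(+)"] refl sum.cong) (auto simp: B_other evec_def)
  \<comment> \<open>For \<open>i\<close> outside \<open>{1..n}\<close> the sum is empty of
    contributions, and the right-hand side agrees since \<alpha> vanishes there and
    \<open>swapK\<close> fixes 0.\<close>
  also have "\<dots> = (\<lambda>i. swapK j (\<alpha> j) * B j i + swapK j (\<alpha> (Suc j)) * B (Suc j) i +
      (if i = j \<or> i = Suc j then 0 else swapK j (\<alpha> i)))"
    using \<alpha> by (intro ext) (auto simp: carrier_Kmod)
  finally show ?thesis .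
qed

lemma Rmap_eq:
  assumes j: "j \<in> {1..<n}" shows "Rmap n j = restrict (Rop j) (carrier (Kmod n))"
proof -
  have B: "R_basis n j k \<in> carrier (Kmod n)" if "k \<in> {1..n}" for k
  proof -
    have "1 - tvar (Suc j) \<in> Kset n" "tvar j \<in> Kset n"
      using j by (auto intro!: lpow_closed Kset_diff)
    then show ?thesis
      using j that by (auto simp: R_basis_def carrier_Kmod evec_def Kmod_def Kring_def)
  qed
  have "(\<Oplus>\<^bsub>Kmod n\<^esub>k\<in>{1..n}. swapK j (\<alpha> k) \<odot>\<^bsub>Kmod n\<^esub> R_basis n j k) = Rop j \<alpha>"
    if "\<alpha> \<in> carrier (Kmod n)" for \<alpha>
    by (subst sum_basis_expand[OF j that B])
      (auto simp: R_basis_def Rop_def evec_def Kmod_def fun_eq_iff)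
  then show ?thesis unfolding Rmap_def by (rule restrict_ext)
qed

lemma Gmap_eq:
  assumes j: "j \<in> {1..<n}" shows "Gmap n j = restrict (Gop j) (carrier (Kmod n))"
proof -
  have B: "G_basis n j k \<in> carrier (Kmod n)" if "k \<in> {1..n}" for k
  proof -
    have "qvar_inv (Suc j) \<in> Kset n" "qvar j \<in> Kset n"
      using j by (auto intro!: lpow_closed)
    then show ?thesis
      using j that by (auto simp: G_basis_def carrier_Kmod evec_def Kmod_def Kring_def)
  qed
  have "(\<Oplus>\<^bsub>Kmod n\<^esub>k\<in>{1..n}. swapK j (\<alpha> k) \<odot>\<^bsub>Kmod n\<^esub> G_basis n j k) = Gop j \<alpha>"
    if "\<alpha> \<in> carrier (Kmod n)" for \<alpha>
    by (subst sum_basis_expand[OF j that B])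
      (auto simp: G_basis_def Gop_def evec_def Kmod_def fun_eq_iff)
  then show ?thesis unfolding Gmap_def by (rule restrict_ext)
qed

section \<open>The representation\<close>

lemma group_AutX: "group (AutX n)"
proof -
  interpret module "Kring n" "Kmod n" by (rule module_Kmod)
  show ?thesis unfolding AutX_def by (intro group_opposite group.AutoGroup M.a_group)
qed

lemma carrier_AutX:
  "f \<in> carrier (AutX n) \<longleftrightarrow> f \<in> extensional (carrier (Kmod n)) \<and>
    bij_betw f (carrier (Kmod n)) (carrier (Kmod n)) \<and>
    (\<forall>u\<in>carrier (Kmod n). \<forall>v\<in>carrier (Kmod n). f (u \<oplus>\<^bsub>Kmod n\<^esub> v) = f u \<oplus>\<^bsub>Kmod n\<^esub> f v)"
  by (auto simp: AutX_def AutoGroup_def auto_def Bij_def hom_def bij_betw_imp_funcset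
      dest: bij_betwE)

lemma AutX_mult:
  "f \<in> carrier (AutX n) \<Longrightarrow> g \<in> carrier (AutX n) \<Longrightarrow> f \<otimes>\<^bsub>AutX n\<^esub> g = compose (carrier (Kmod n)) g f"
  by (auto simp: AutX_def AutoGroup_def auto_def BijGroup_def)

lemma AutX_one: "\<one>\<^bsub>AutX n\<^esub> = (\<lambda>x\<in>carrier (Kmod n). x)"
  by (simp add: AutX_def AutoGroup_def BijGroup_def)

lemma Rmap_AutX:
  assumes j: "j \<in> {1..<n}" shows "Rmap n j \<in> carrier (AutX n)"
proof -
  have "bij_betw (Rop j) (carrier (Kmod n)) (carrier (Kmod n))"
    by (rule bij_betw_byWitness[where f' = "Rop_inv j"])
      (use op_closed[OF j] in \<open>auto simp: Rop_Rop_inv Rop_inv_Rop\<close>)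
  moreover have "u \<oplus>\<^bsub>Kmod n\<^esub> v \<in> carrier (Kmod n)"
    if "u \<in> carrier (Kmod n)" "v \<in> carrier (Kmod n)" for u v
    using that by (auto simp: Kmod_def Kring_def)
  moreover have "Rop j (u \<oplus>\<^bsub>Kmod n\<^esub> v) = Rop j u \<oplus>\<^bsub>Kmod n\<^esub> Rop j v" for u v
    by (auto simp: Kmod_def Rop_def swapK_add algebra_simps fun_eq_iff)
  ultimately show ?thesis
    by (simp add: carrier_AutX Rmap_eq[OF j] cong: bij_betw_cong)
qed

lemma Gmap_AutX:
  assumes j: "j \<in> {1..<n}" shows "Gmap n j \<in> carrier (AutX n)"
proof -
  have "bij_betw (Gop j) (carrier (Kmod n)) (carrier (Kmod n))"
    by (rule bij_betw_byWitness[where f' = "Gop j"])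
      (use op_closed[OF j] in \<open>auto simp: Gop_Gop\<close>)
  moreover have "u \<oplus>\<^bsub>Kmod n\<^esub> v \<in> carrier (Kmod n)"
    if "u \<in> carrier (Kmod n)" "v \<in> carrier (Kmod n)" for u v
    using that by (auto simp: Kmod_def Kring_def)
  moreover have "Gop j (u \<oplus>\<^bsub>Kmod n\<^esub> v) = Gop j u \<oplus>\<^bsub>Kmod n\<^esub> Gop j v" for u v
    by (auto simp: Kmod_def Gop_def swapK_add algebra_simps fun_eq_iff)
  ultimately show ?thesis
    by (simp add: carrier_AutX Gmap_eq[OF j] cong: bij_betw_cong)
qed

section \<open>Defining relations, existence and uniqueness\<close>

definition phi_gen :: "nat \<Rightarrow> vb_gen \<Rightarrow> (nat \<Rightarrow> laurent) \<Rightarrow> nat \<Rightarrow> laurent"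
  where "phi_gen n g = (case g of Sig j \<Rightarrow> Rmap n j | Rho j \<Rightarrow> Gmap n j)"

lemma phi_gen_closed: "phi_gen n ` vb_gens n \<subseteq> carrier (AutX n)"
  by (auto simp: phi_gen_def vb_gens_def Rmap_AutX Gmap_AutX)

text \<open>Unrestricted counterpart of \<open>phi_gen\<close>, for which products are ordinary
  compositions.\<close>

definition gen_op :: "vb_gen \<Rightarrow> (nat \<Rightarrow> laurent) \<Rightarrow> nat \<Rightarrow> laurent"
  where "gen_op g = (case g of Sig j \<Rightarrow> Rop j | Rho j \<Rightarrow> Gop j)"

lemma phi_gen_eq: "g \<in> vb_gens n \<Longrightarrow> phi_gen n g = restrict (gen_op g) (carrier (Kmod n))"
  by (auto simp: phi_gen_def gen_op_def vb_gens_def Rmap_eq Gmap_eq)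

lemma gen_op_closed:
  "g \<in> vb_gens n \<Longrightarrow> \<alpha> \<in> carrier (Kmod n) \<Longrightarrow> gen_op g \<alpha> \<in> carrier (Kmod n)"
  by (auto simp: gen_op_def vb_gens_def op_closed)

text \<open>In \<open>AutX n\<close> the left factor acts first, so letters are applied from left to
  right, as in \<open>fold\<close>. The restriction is harmless since each \<open>gen_op\<close>
  preserves the carrier.\<close>

lemma word_eval_phi_gen:
  assumes "set gs \<subseteq> vb_gens n"
  shows "word_eval (AutX n) (phi_gen n) (map (\<lambda>g. (g, True)) gs) =
    restrict (fold gen_op gs) (carrier (Kmod n))"
  using assms
proof (induction gs)
  case Nil
  show ?case by (simp add: AutX_one restrict_def)
next
  case (Cons g gs)
  have "map (\<lambda>g. (g, True)) gs \<in> gwords (vb_gens n)"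
    using Cons.prems by (auto simp: gwords_def)
  then have "word_eval (AutX n) (phi_gen n) (map (\<lambda>g. (g, True)) gs) \<in> carrier (AutX n)"
    by (rule word_eval_closed[OF group_AutX phi_gen_closed])
  moreover have "phi_gen n g \<in> carrier (AutX n)" using phi_gen_closed Cons.prems by auto
  ultimately show ?case
    using Cons by (auto simp: AutX_mult phi_gen_eq gen_op_closed compose_def fun_eq_iff restrict_def)
qed

lemma phi_gen_rels:
  assumes "(l, r) \<in> vb_rels n"
  shows "word_eval (AutX n) (phi_gen n) l = word_eval (AutX n) (phi_gen n) r"
proof -
  \<comment> \<open>All letters in the defining relations are positive, so each relation reduces to
    an equation of folds, which the coordinate identities settle.\<close>
  have *: "l = map (\<lambda>g. (g, True)) (map fst l)" "r = map (\<lambda>g. (g, True)) (map fst r)"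
      "fold gen_op (map fst l) = fold gen_op (map fst r)"
    using assms
    by (auto simp: vb_rels_def Let_def gen_op_def fun_eq_iff Rop_braid Gop_braid Gop_Rop_Gop op_far
        Gop_Gop)
  moreover have "l \<in> gwords (vb_gens n)" "r \<in> gwords (vb_gens n)"
    using assms vb_rels_gwords by blast+
  then have "set (map fst l) \<subseteq> vb_gens n" "set (map fst r) \<subseteq> vb_gens n"
    by (auto simp: gwords_def)
  ultimately show ?thesis using word_eval_phi_gen by metis
qed

lemma extends_phi3B_iff:
  "extends_phi3B n \<phi> \<longleftrightarrow> \<phi> \<in> hom (VB n) (AutX n) \<and>
    (\<forall>g\<in>vb_gens n. \<phi> (pgen (vb_gens n) (vb_rels n) g) = phi_gen n g)"
  by (auto simp: extends_phi3B_def vb_sigma_def vb_rho_def phi_gen_def vb_gens_def)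

text \<open>\<open>extends_phi3B\<close> constrains a map on the carrier only; extensionality fixes
  it elsewhere and makes uniqueness meaningful.\<close>

lemma ex1_extends_phi3B: "\<exists>!\<phi>. \<phi> \<in> extensional (carrier (VB n)) \<and> extends_phi3B n \<phi>"
proof (rule ex_ex1I)
  let ?\<phi> = "presented_lift (vb_gens n) (vb_rels n) (AutX n) (phi_gen n)"
  have "?\<phi> \<in> hom (VB n) (AutX n)"
    unfolding VB_def by (rule presented_lift_hom(1)[OF group_AutX phi_gen_closed phi_gen_rels])
  \<comment> \<open>Restriction makes the lift extensional. The generators lie in the carrier, so
    their images are unchanged.\<close>
  then have "restrict ?\<phi> (carrier (VB n)) \<in> hom (VB n) (AutX n)"
    by (rule group.hom_restrict[OF group_VB]) simp
  moreover have "?\<phi> (pgen (vb_gens n) (vb_rels n) g) = phi_gen n g" if "g \<in> vb_gens n" for g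
    by (rule presented_lift_hom(2)[OF group_AutX phi_gen_closed phi_gen_rels that])
  ultimately have "extends_phi3B n (restrict ?\<phi> (carrier (VB n)))"
    by (simp add: extends_phi3B_iff VB_def pgen_in_carrier)
  then show "\<exists>\<phi>. \<phi> \<in> extensional (carrier (VB n)) \<and> extends_phi3B n \<phi>" by blast
next
  fix \<phi> \<psi>
  assume \<phi>: "\<phi> \<in> extensional (carrier (VB n)) \<and> extends_phi3B n \<phi>"
    and \<psi>: "\<psi> \<in> extensional (carrier (VB n)) \<and> extends_phi3B n \<psi>"
  have "\<phi> A = \<psi> A" if "A \<in> carrier (VB n)" for A
    by (rule presented_hom_unique[OF group_AutX[of n], of \<phi> "vb_gens n" "vb_rels n" \<psi>])
      (use \<phi> \<psi> that in \<open>simp_all add: extends_phi3B_iff flip: VB_def\<close>)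
  then show "\<phi> = \<psi>"
    using \<phi> \<psi> by (blast intro: extensionalityI)
qed

section \<open>Semilinearity and linearity on the pure subgroup\<close>

definition semilinear :: "nat \<Rightarrow> (nat \<Rightarrow> nat) \<Rightarrow> ((nat \<Rightarrow> laurent) \<Rightarrow> nat \<Rightarrow> laurent) \<Rightarrow> bool"
  where "semilinear n p f \<longleftrightarrow> (\<forall>a\<in>Kset n. \<forall>v\<in>carrier (Kmod n).
    f (a \<odot>\<^bsub>Kmod n\<^esub> v) = permK p a \<odot>\<^bsub>Kmod n\<^esub> f v)"

lemma smult_closed: "a \<in> Kset n \<Longrightarrow> v \<in> carrier (Kmod n) \<Longrightarrow> a \<odot>\<^bsub>Kmod n\<^esub> v \<in> carrier (Kmod n)"
  by (auto simp: Kmod_def Kring_def)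

definition gen_index :: "vb_gen \<Rightarrow> nat"
  where "gen_index g = (case g of Sig j \<Rightarrow> j | Rho j \<Rightarrow> j)"

text \<open>Every term of either kind of generator contains exactly one swapped coordinate, so the
  scalar comes out swapped once.\<close>

lemma gen_op_smult:
  "gen_op g (a \<odot>\<^bsub>Kmod n\<^esub> v) = swapK (gen_index g) a \<odot>\<^bsub>Kmod n\<^esub> gen_op g v"
  by (cases g) (auto simp: gen_op_def gen_index_def Kmod_def Rop_def Gop_def swapK_mult algebra_simps fun_eq_iff)

text \<open>The inverse has the same twist as the generator because the swap is an
  involution.\<close>

lemma semilinear_phi_gen:
  assumes g: "g \<in> vb_gens n" and j: "j = gen_index g"
  shows "semilinear n (transpose j (Suc j)) (phi_gen n g)"
    and "semilinear n (transpose j (Suc j)) (inv\<^bsub>AutX n\<^esub> (phi_gen n g))"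
proof -
  interpret group "AutX n" by (rule group_AutX)
  let ?M = "carrier (Kmod n)" and ?f = "phi_gen n g" and ?h = "inv\<^bsub>AutX n\<^esub> (phi_gen n g)"
  have sw: "permK (transpose j (Suc j)) = swapK j" by (simp add: swapK_eq_permK)
  have jn: "j \<in> {1..<n}" using g j by (auto simp: vb_gens_def gen_index_def)
  have f_smult: "?f (a \<odot>\<^bsub>Kmod n\<^esub> v) = swapK j a \<odot>\<^bsub>Kmod n\<^esub> ?f v" if "a \<in> Kset n" "v \<in> ?M" for a v
    using that by (simp add: phi_gen_eq[OF g] smult_closed gen_op_smult j)
  then show "semilinear n (transpose j (Suc j)) ?f"
    by (simp add: semilinear_def sw)
  have f: "?f \<in> carrier (AutX n)" using phi_gen_closed g by auto
  then have h: "?h \<in> carrier (AutX n)" by simp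
  have hM: "?h v \<in> ?M" if "v \<in> ?M" for v
    using h that unfolding carrier_AutX by (blast dest: bij_betwE)
  \<comment> \<open>The right factor of a product in \<open>AutX n\<close> is the outer function, so
    applying \<open>?h\<close> and then \<open>?f\<close> is governed by
    \<open>l_inv\<close>.\<close>
  have fh: "compose ?M ?f ?h = \<one>\<^bsub>AutX n\<^esub>"
    by (rule HOL.trans[OF AutX_mult[OF h f, symmetric] l_inv[OF f]])
  have hf: "compose ?M ?h ?f = \<one>\<^bsub>AutX n\<^esub>"
    by (rule HOL.trans[OF AutX_mult[OF f h, symmetric] r_inv[OF f]])
  have fh: "?f (?h v) = v" and hf: "?h (?f v) = v" if "v \<in> ?M" for v
    using fun_cong[OF fh, of v] fun_cong[OF hf, of v]
    by (simp_all only: compose_eq[OF that] AutX_one restrict_apply'[OF that])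
  have "?h (a \<odot>\<^bsub>Kmod n\<^esub> v) = swapK j a \<odot>\<^bsub>Kmod n\<^esub> ?h v" if av: "a \<in> Kset n" "v \<in> ?M" for a v
  proof -
    have a': "swapK j a \<in> Kset n" using swapK_closed[OF jn] av by simp
    \<comment> \<open>The candidate for the value of \<open>?h\<close> is tested by applying
      \<open>?f\<close>: the second swap undoes the first. Applying \<open>?h\<close> to this
      equation identifies the value.\<close>
    have "?f (swapK j a \<odot>\<^bsub>Kmod n\<^esub> ?h v) = a \<odot>\<^bsub>Kmod n\<^esub> v"
      using f_smult[OF a' hM[OF av(2)]] fh[OF av(2)] by simp
    moreover have "?h (?f (swapK j a \<odot>\<^bsub>Kmod n\<^esub> ?h v)) = swapK j a \<odot>\<^bsub>Kmod n\<^esub> ?h v"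
      by (rule hf[OF smult_closed[OF a' hM[OF av(2)]]])
    ultimately show ?thesis by (simp only:)
  qed
  then show "semilinear n (transpose j (Suc j)) ?h"
    by (simp add: semilinear_def sw)
qed

text \<open>Both groups are opposites, so the first letter acts first on either side and the twists
  compose in matching order. Fixing \<open>p\<close> on generators only makes the lemma applicable
  to values of \<open>vb_perm\<close>.\<close>

lemma semilinear_word_eval:
  assumes "w \<in> gwords (vb_gens n)"
    and "\<And>g. g \<in> vb_gens n \<Longrightarrow> p g = transpose (gen_index g) (Suc (gen_index g))"
  shows "semilinear n (word_eval (opposite (sym_group n)) p w) (word_eval (AutX n) (phi_gen n) w)"
  using assms(1)
proof (induction w)
  case Nil
  show ?case
    by (simp add: semilinear_def sym_group_one[unfolded id_def] AutX_one permK_id[unfolded id_def] smult_closed)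
next
  case (Cons x w)
  interpret A: group "AutX n" by (rule group_AutX)
  interpret S: group "opposite (sym_group n)" by (rule group_opposite[OF sym_group_is_group])
  obtain g b where x: "x = (g, b)" by force
  have g: "g \<in> vb_gens n" "w \<in> gwords (vb_gens n)" using Cons.prems x by auto
  define j where "j = gen_index g"
  have jn: "j \<in> {1..<n}" using g by (auto simp: vb_gens_def gen_index_def j_def)
  have p_closed: "p ` vb_gens n \<subseteq> carrier (opposite (sym_group n))"
    using assms(2) by (auto simp: vb_gens_def sym_group_carrier gen_index_def intro!: permutes_swap_id)
  have "inv\<^bsub>opposite (sym_group n)\<^esub> (p g) = p g"
    using p_closed g assms(2)
    by (intro S.inv_equality) (auto simp: sym_group_mult sym_group_one)
  \<comment> \<open>A transposition is its own inverse, so the sign of the letter does not affect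
    the permutation.\<close>
  then have pe: "(if b then p g else inv\<^bsub>opposite (sym_group n)\<^esub> (p g)) = transpose j (Suc j)"
    using assms(2)[OF g(1)] by (simp add: j_def)
  let ?q = "word_eval (opposite (sym_group n)) p w"
  have "?q \<in> carrier (opposite (sym_group n))"
    by (rule word_eval_closed[OF S.is_group p_closed g(2)])
  then have q: "bij ?q" by (simp add: sym_group_carrier permutes_bij)
  let ?f = "if b then phi_gen n g else inv\<^bsub>AutX n\<^esub> (phi_gen n g)"
  have f: "?f \<in> carrier (AutX n)" "word_eval (AutX n) (phi_gen n) w \<in> carrier (AutX n)"
    using phi_gen_closed g word_eval_closed[OF group_AutX phi_gen_closed g(2)] by auto
  have sf: "semilinear n (transpose j (Suc j)) ?f"
    using semilinear_phi_gen[OF g(1) j_def] by simp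
  have fM: "?f v \<in> carrier (Kmod n)" if "v \<in> carrier (Kmod n)" for v
    using f(1) that unfolding carrier_AutX by (blast dest: bij_betwE)
  have "semilinear n (?q \<circ> transpose j (Suc j)) (compose (carrier (Kmod n)) (word_eval (AutX n) (phi_gen n) w) ?f)"
    unfolding semilinear_def
  proof (intro ballI)
    fix a v assume av: "a \<in> Kset n" "v \<in> carrier (Kmod n)"
    \<comment> \<open>The induction hypothesis is applied to a scalar and a vector already
      transformed by the first letter, so both must stay in their domains.\<close>
    have a': "permK (transpose j (Suc j)) a \<in> Kset n"
      using swapK_closed[OF jn av(1)] by (simp add: swapK_eq_permK)
    have "word_eval (AutX n) (phi_gen n) w (?f (a \<odot>\<^bsub>Kmod n\<^esub> v)) =
        permK ?q (permK (transpose j (Suc j)) a) \<odot>\<^bsub>Kmod n\<^esub> word_eval (AutX n) (phi_gen n) w (?f v)"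
      using sf Cons.IH[OF g(2)] av a' fM[OF av(2)] unfolding semilinear_def by metis
    then show "compose (carrier (Kmod n)) (word_eval (AutX n) (phi_gen n) w) ?f (a \<odot>\<^bsub>Kmod n\<^esub> v) =
        permK (?q \<circ> transpose j (Suc j)) a \<odot>\<^bsub>Kmod n\<^esub>
          compose (carrier (Kmod n)) (word_eval (AutX n) (phi_gen n) w) ?f v"
      using av q by (simp add: compose_eq smult_closed permK_comp)
  qed
  moreover have "word_eval (opposite (sym_group n)) p (x # w) = ?q \<circ> transpose j (Suc j)"
    using pe by (simp only: word_eval.simps x fst_conv snd_conv opposite_simps sym_group_mult)
  moreover have "word_eval (AutX n) (phi_gen n) (x # w) =
      compose (carrier (Kmod n)) (word_eval (AutX n) (phi_gen n) w) ?f"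
    using f by (simp only: word_eval.simps x fst_conv snd_conv AutX_mult)
  ultimately show ?case by (simp only:)
qed

text \<open>A representing word for \<open>A\<close> is chosen once and both homomorphisms are
  evaluated on it.\<close>

lemma semilinear_extends_phi3B:
  assumes \<phi>: "extends_phi3B n \<phi>" and "A \<in> carrier (VB n)"
  shows "semilinear n (vb_perm n A) (\<phi> A)"
proof -
  obtain w where w: "w \<in> gwords (vb_gens n)" "A = word_cong (vb_gens n) (vb_rels n) `` {w}"
    using assms(2) unfolding VB_def by (rule presented_carrierE)
  let ?p = "\<lambda>g. vb_perm n (pgen (vb_gens n) (vb_rels n) g)"
  have "\<phi> A = word_eval (AutX n) (\<lambda>g. \<phi> (pgen (vb_gens n) (vb_rels n) g)) w"
    unfolding w(2) by (rule presented_hom_eval[OF group_AutX _ w(1)])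
      (use \<phi> in \<open>simp add: extends_phi3B_def VB_def\<close>)
  also have "\<dots> = word_eval (AutX n) (phi_gen n) w"
    using \<phi> by (intro word_eval_fun_cong[OF w(1)]) (simp add: extends_phi3B_iff)
  finally have "\<phi> A = word_eval (AutX n) (phi_gen n) w" .
  moreover have "vb_perm n A = word_eval (opposite (sym_group n)) ?p w"
    unfolding w(2) by (rule presented_hom_eval[OF group_opposite[OF sym_group_is_group] _ w(1)])
      (use vb_perm_hom(1) in \<open>simp add: VB_def\<close>)
  moreover have "?p g = transpose (gen_index g) (Suc (gen_index g))" if "g \<in> vb_gens n" for g
    using that vb_perm_hom(2,3)[of _ n]
    by (auto simp: vb_gens_def gen_index_def vb_sigma_def vb_rho_def)
  ultimately show ?thesis using semilinear_word_eval[OF w(1)] by simp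
qed

text \<open>The product of \<open>GL n\<close> is that of \<open>AutX n\<close>, so multiplicativity
  is inherited and only linearity of the values is new.\<close>

lemma extends_phi3B_hom_GL:
  assumes \<phi>: "extends_phi3B n \<phi>"
  shows "\<phi> \<in> hom ((VB n)\<lparr>carrier := VP n\<rparr>) (GL n)"
proof (rule homI)
  have hom: "\<phi> \<in> hom (VB n) (AutX n)" using \<phi> by (simp add: extends_phi3B_def)
  have VP: "A \<in> carrier (VB n)" "vb_perm n A = id" if "A \<in> VP n" for A
    using that by (auto simp: VP_def kernel_def sym_group_one)
  fix A assume "A \<in> carrier ((VB n)\<lparr>carrier := VP n\<rparr>)"
  then have A: "A \<in> VP n" by simp
  \<comment> \<open>An element of the kernel has trivial permutation, so the twist is
    \<open>permK id\<close>, the identity on scalars.\<close>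
  have "semilinear n id (\<phi> A)"
    using semilinear_extends_phi3B[OF \<phi> VP(1)[OF A]] VP(2)[OF A] by simp
  then show "\<phi> A \<in> carrier (GL n)"
    using hom_in_carrier[OF hom VP(1)[OF A]]
    by (simp add: GL_def semilinear_def permK_id Kring_def)
  fix B assume "B \<in> carrier ((VB n)\<lparr>carrier := VP n\<rparr>)"
  then have B: "B \<in> VP n" by simp
  show "\<phi> (A \<otimes>\<^bsub>(VB n)\<lparr>carrier := VP n\<rparr>\<^esub> B) = \<phi> A \<otimes>\<^bsub>GL n\<^esub> \<phi> B"
    using hom_mult[OF hom VP(1)[OF A] VP(1)[OF B]] by (simp add: GL_def)
qed

theorem theorem5:
  fixes n :: nat
  assumes "n \<ge> 2"
  shows "(\<forall>j\<in>{1..<n}. Rmap n j \<in> carrier (AutX n) \<and> Gmap n j \<in> carrier (AutX n)) \<and>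
    (\<exists>!\<phi>. \<phi> \<in> extensional (carrier (VB n)) \<and> extends_phi3B n \<phi>) \<and>
    (\<forall>\<phi>. extends_phi3B n \<phi> \<longrightarrow> \<phi> \<in> hom ((VB n)\<lparr>carrier := VP n\<rparr>) (GL n))"
  by (intro conjI ballI allI impI Rmap_AutX Gmap_AutX ex1_extends_phi3B extends_phi3B_hom_GL)

end
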